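(* Let $\hat U=(\hat h,\hat q)\in\mathbb{R}^K\times\mathbb{R}^K$. If the symmetric matrix $\mathcal{P}(\hat h)$ is strictly positive definite, then the stochastic Galerkin shallow water system $\hat U_t+(F(\hat U))_x=S(\hat U,\hat B)$ is hyperbolic; that is, the $2K\times 2K$ flux Jacobian $J(\hat U)=\frac{\partial F}{\partial \hat U}$ is diagonalizable (over $\mathbb{R}$) with real eigenvalues.
   Context: Let $\rho:\mathbb{R}^d\to\mathbb{R}$ be a (Lebesgue) probability density with finite polynomial moments of all orders and $\langle f,g\rangle_\rho=\int_{\mathbb{R}^d} f g\,\rho\,ds$. Let $\Lambda\subset\mathbb{N}_0^d$ be a finite set of multi-indices with $0\in\Lambda$ and $|\Lambda|=K$, let $P_\Lambda=\mathrm{span}\{\zeta^\nu : \nu\in\Lambda\}$, and let $\phi_1\equiv 1,\phi_2,\dots,\phi_K$ be an $L^2_\rho$-orthonormal basis of $P_\Lambda$. For $\hat y\in\mathbb{R}^K$ define $\mathcal{P}(\hat y)=\sum_{k=1}^K\hat y_k\mathcal{M}_k\in\mathbb{R}^{K\times K}$, where $(\mathcal{M}_k)_{\ell m}=\langle\phi_k,\phi_\ell\phi_m\rangle_\rho$. Each $\mathcal{M}_k$ is symmetric, and $\mathcal{P}(\hat y)\hat z=\mathcal{P}(\hat z)\hat y$. Let $g>0$ be the gravitational constant. The stochastic Galerkin shallow water system for the unknown $\hat U=(\hat h,\hat q)$, with $\hat h(x,t),\hat q(x,t)\in\mathbb{R}^K$, and with a given bottom-topography coefficient vector $\hat B(x)\in\mathbb{R}^K$,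 is $\hat U_t+(F(\hat U))_x=S(\hat U,\hat B)$, where $$F(\hat U)=\begin{pmatrix}\hat q\\ \tfrac12 g\mathcal{P}(\hat h)\hat h+\mathcal{P}(\hat q)\mathcal{P}^{-1}(\hat h)\hat q\end{pmatrix},\qquad S(\hat U,\hat B)=\begin{pmatrix}0\\-g\mathcal{P}(\hat h)\hat B_x\end{pmatrix}.$$ With $\hat u=\mathcal{P}^{-1}(\hat h)\hat q$, its flux Jacobian is $$J(\hat U)=\frac{\partial F}{\partial\hat U}=\begin{pmatrix}O&I\\ g\mathcal{P}(\hat h)-\mathcal{P}(\hat q)\mathcal{P}^{-1}(\hat h)\mathcal{P}(\hat u)&\mathcal{P}(\hat u)+\mathcal{P}(\hat q)\mathcal{P}^{-1}(\hat h)\end{pmatrix}.$$ The system is called hyperbolic (at the state $\hat U$) if $J(\hat U)$ is diagonalizable with real eigenvalues. *)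

theory Defs
  imports "HOL-Analysis.Analysis"
begin

section \<open>Polynomial spaces and orthonormal bases\<close>

definition monomial :: "('d::finite \<Rightarrow> nat) \<Rightarrow> real^'d \<Rightarrow> real" where
  "monomial \<nu> s = (\<Prod>i\<in>UNIV. (s $ i) ^ \<nu> i)"

text \<open>Used only for finite index sets, where it is the linear span of the family.\<close>

definition family_span :: "('i \<Rightarrow> 'a \<Rightarrow> real) \<Rightarrow> 'i set \<Rightarrow> ('a \<Rightarrow> real) set" where
  "family_span f I = {\<lambda>s. \<Sum>i\<in>I. c i * f i s | c. True}"

abbreviation poly_space :: "('d::finite \<Rightarrow> nat) set \<Rightarrow> (real^'d \<Rightarrow> real) set" where
  "poly_space \<Lambda> \<equiv> family_span monomial \<Lambda>"

text \<open>Probability densities with respect to Lebesgue measure; Lebesgue rather than Borel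
  measurability is required, which is the more general reading.\<close>

definition prob_density :: "(real^'d::finite \<Rightarrow> real) \<Rightarrow> bool" where
  "prob_density \<rho> \<longleftrightarrow> (\<forall>s. 0 \<le> \<rho> s) \<and> integrable lebesgue \<rho> \<and> integral\<^sup>L lebesgue \<rho> = 1"

definition finite_moments :: "(real^'d::finite \<Rightarrow> real) \<Rightarrow> bool" where
  "finite_moments \<rho> \<longleftrightarrow> (\<forall>\<nu>. integrable lebesgue (\<lambda>s. monomial \<nu> s * \<rho> s))"

definition weighted_inner ::
    "(real^'d::finite \<Rightarrow> real) \<Rightarrow> (real^'d \<Rightarrow> real) \<Rightarrow> (real^'d \<Rightarrow> real) \<Rightarrow> real" where
  "weighted_inner \<rho> f g = (\<integral>s. f s * g s * \<rho> s \<partial>lebesgue)"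

text \<open>Linear independence is not listed separately: it follows from orthonormality.\<close>

definition orthonormal_basis ::
    "(real^'d::finite \<Rightarrow> real) \<Rightarrow> (real^'d \<Rightarrow> real) set \<Rightarrow> ('k::finite \<Rightarrow> real^'d \<Rightarrow> real) \<Rightarrow> bool" where
  "orthonormal_basis \<rho> V \<phi> \<longleftrightarrow>
     (\<forall>k l. weighted_inner \<rho> (\<phi> k) (\<phi> l) = (if k = l then 1 else 0)) \<and>
     family_span \<phi> UNIV = V"

section \<open>Galerkin matrices\<close>

definition galerkin_M ::
    "(real^'d::finite \<Rightarrow> real) \<Rightarrow> ('k::finite \<Rightarrow> real^'d \<Rightarrow> real) \<Rightarrow> 'k \<Rightarrow> real^'k^'k" where
  "galerkin_M \<rho> \<phi> k = (\<chi> l m. weighted_inner \<rho> (\<phi> k) (\<lambda>s. \<phi> l s * \<phi> m s))"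

definition galerkin_P ::
    "(real^'d::finite \<Rightarrow> real) \<Rightarrow> ('k::finite \<Rightarrow> real^'d \<Rightarrow> real) \<Rightarrow> real^'k \<Rightarrow> real^'k^'k" where
  "galerkin_P \<rho> \<phi> y = (\<Sum>k\<in>UNIV. (y $ k) *\<^sub>R galerkin_M \<rho> \<phi> k)"

text \<open>Symmetry is not part of this predicate; the matrices \<open>galerkin_P \<rho> \<phi> y\<close> are
  symmetric by construction.\<close>

definition strictly_pos_def :: "real^'n^'n::finite \<Rightarrow> bool" where
  "strictly_pos_def A \<longleftrightarrow> (\<forall>v. v \<noteq> 0 \<longrightarrow> 0 < v \<bullet> (A *v v))"

section \<open>Balance laws and hyperbolicity\<close>

text \<open>One-dimensional balance laws \<open>U\<^sub>t + (F U)\<^sub>x = S x U\<close>. The source may depend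
  on \<open>x\<close> explicitly, e.g. through the bottom topography.\<close>

record 'n balance_law =
  flux :: "real^'n \<Rightarrow> real^'n"
  source :: "real \<Rightarrow> real^'n \<Rightarrow> real^'n"

text \<open>Diagonalizable over the reals; in particular all eigenvalues are real.\<close>

definition real_diagonalizable :: "real^'n^'n::finite \<Rightarrow> bool" where
  "real_diagonalizable A \<longleftrightarrow>
     (\<exists>(Q :: real^'n^'n) (D :: real^'n^'n).
        invertible Q \<and> (\<forall>i j. i \<noteq> j \<longrightarrow> D $ i $ j = 0) \<and> A = Q ** D ** matrix_inv Q)"

text \<open>The library's \<open>jacobian\<close> is only meaningful at points of differentiability,
  hence the first conjunct.\<close>

definition hyperbolic_at :: "'n::finite balance_law \<Rightarrow> real^'n \<Rightarrow> bool" where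
  "hyperbolic_at L U \<longleftrightarrow>
     flux L differentiable (at U) \<and> real_diagonalizable (jacobian (flux L) (at U))"

section \<open>The stochastic Galerkin shallow water system\<close>

text \<open>Vectors in \<open>\<real>\<^sup>K \<times> \<real>\<^sup>K\<close> are vectors indexed by the sum type \<open>'k + 'k\<close>, so that
  the flux Jacobian is a \<open>2K \<times> 2K\<close> matrix.\<close>

definition vjoin :: "real^'k \<Rightarrow> real^'k \<Rightarrow> real^('k::finite + 'k)" where
  "vjoin h q = (\<chi> i. case i of Inl a \<Rightarrow> h $ a | Inr a \<Rightarrow> q $ a)"

definition vfst :: "real^('k::finite + 'k) \<Rightarrow> real^'k" where
  "vfst U = (\<chi> a. U $ Inl a)"

definition vsnd :: "real^('k::finite + 'k) \<Rightarrow> real^'k" where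
  "vsnd U = (\<chi> a. U $ Inr a)"

definition sgswe_flux ::
    "(real^'d::finite \<Rightarrow> real) \<Rightarrow> ('k::finite \<Rightarrow> real^'d \<Rightarrow> real) \<Rightarrow> real
      \<Rightarrow> real^('k + 'k) \<Rightarrow> real^('k + 'k)" where
  "sgswe_flux \<rho> \<phi> g U =
     (let h = vfst U; q = vsnd U; P = galerkin_P \<rho> \<phi> in
        vjoin q ((g / 2) *\<^sub>R (P h *v h) + (P q ** matrix_inv (P h)) *v q))"

definition sgswe_source ::
    "(real^'d::finite \<Rightarrow> real) \<Rightarrow> ('k::finite \<Rightarrow> real^'d \<Rightarrow> real) \<Rightarrow> real \<Rightarrow> (real \<Rightarrow> real^'k)
      \<Rightarrow> real \<Rightarrow> real^('k + 'k) \<Rightarrow> real^('k + 'k)" where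
  "sgswe_source \<rho> \<phi> g B x U =
     vjoin 0 (- (g *\<^sub>R (galerkin_P \<rho> \<phi> (vfst U) *v vector_derivative B (at x))))"

definition sgswe ::
    "(real^'d::finite \<Rightarrow> real) \<Rightarrow> ('k::finite \<Rightarrow> real^'d \<Rightarrow> real) \<Rightarrow> real \<Rightarrow> (real \<Rightarrow> real^'k)
      \<Rightarrow> ('k + 'k) balance_law" where
  "sgswe \<rho> \<phi> g B = \<lparr>flux = sgswe_flux \<rho> \<phi> g, source = sgswe_source \<rho> \<phi> g B\<rparr>"

end

theory Submission
  imports Defs
begin

text \<open>Put \<open>u = P(h)\<^sup>-\<^sup>1 q\<close>. Since \<open>P(y) z = P(z) y\<close>, differentiating
  \<open>P(h) u = q\<close> gives \<open>\<delta>u = P(h)\<^sup>-\<^sup>1 (\<delta>q - P(u) \<delta>h)\<close>, so it is natural to use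
  \<open>\<delta>h\<close> and \<open>w = \<delta>q - P(u) \<delta>h\<close> as coordinates. The Jacobian is self-adjoint for the form
  \<open>g |\<delta>h|\<^sup>2 + w \<bullet> P(h)\<^sup>-\<^sup>1 w\<close>, which is positive definite because \<open>P(h)\<close> is. An operator
  that is self-adjoint for a positive definite form has a spanning set of eigenvectors: the
  orthogonal complement of all eigenvectors is invariant, hence zero, since a nonzero
  invariant subspace contains an eigenvector.\<close>

section \<open>Operators that are self-adjoint for a positive definite form\<close>

text \<open>The eigenvector maximizes the Rayleigh quotient \<open>\<beta> x (f x) / \<beta> x x\<close>.\<close>

lemma self_adjoint_invariant_subspace_eigenvector:
  fixes f :: "'a::euclidean_space \<Rightarrow> 'a" and \<beta> :: "'a \<Rightarrow> 'a \<Rightarrow> real"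
  assumes \<beta>: "bounded_bilinear \<beta>" and sym: "\<And>x y. \<beta> x y = \<beta> y x"
    and pos: "\<And>x. x \<noteq> 0 \<Longrightarrow> 0 < \<beta> x x"
    and f: "linear f" and self_adj: "\<And>x y. \<beta> (f x) y = \<beta> x (f y)"
    and W: "subspace W" "W \<noteq> {0}" and inv: "\<And>x. x \<in> W \<Longrightarrow> f x \<in> W"
  obtains x c where "x \<in> W" "x \<noteq> 0" "f x = c *\<^sub>R x"
proof -
  interpret \<beta>: bounded_bilinear \<beta> by (rule \<beta>)
  note f_simps = linear_add[OF f] linear_scale[OF f]
  define K where "K = sphere 0 1 \<inter> W"
  have "compact K"
    unfolding K_def by (intro compact_Int_closed closed_subspace W) simp
  moreover obtain w where w: "w \<in> W" "w \<noteq> 0"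
    using W subspace_0 by blast
  then have "(1 / norm w) *\<^sub>R w \<in> K"
    unfolding K_def by (simp add: subspace_scale W)
  then have "K \<noteq> {}" by blast
  moreover have "continuous_on K (\<lambda>x. \<beta> x (f x) / \<beta> x x)"
    by (intro continuous_intros \<beta>.continuous_on linear_continuous_on linear_linear[THEN iffD2] f)
      (metis (full_types) pos K_def IntD1 less_irrefl mem_sphere_0 norm_zero zero_neq_one)
  ultimately obtain x where x: "x \<in> K" and max: "\<forall>y\<in>K. \<beta> y (f y) / \<beta> y y \<le> \<beta> x (f x) / \<beta> x x"
    using continuous_attains_sup[of K "\<lambda>x. \<beta> x (f x) / \<beta> x x"] by auto
  define c where "c = \<beta> x (f x) / \<beta> x x"
  have xW: "x \<in> W" and x0: "x \<noteq> 0" using x unfolding K_def by auto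
  \<comment> \<open>The quotient is homogeneous of degree zero, so its maximum over the unit vectors
    of \<open>W\<close> bounds it on all nonzero vectors of \<open>W\<close>.\<close>
  have c_le: "\<beta> y (f y) \<le> c * \<beta> y y" if y: "y \<in> W" for y
  proof (cases "y = 0")
    case True then show ?thesis by (simp add: \<beta>.zero_left)
  next
    case False
    let ?z = "(1 / norm y) *\<^sub>R y"
    have "?z \<in> K" unfolding K_def using False y by (simp add: subspace_scale W)
    from bspec[OF max this] have "\<beta> y (f y) / \<beta> y y \<le> c"
      using False by (simp add: c_def f_simps \<beta>.scaleR_left \<beta>.scaleR_right)
    then show ?thesis using pos[OF False] by (simp add: pos_divide_le_eq)
  qed
  \<comment> \<open>The residual \<open>e\<close> lies in \<open>W\<close> by invariance, so
    \<open>x\<close> may be perturbed along it; maximality at \<open>x\<close> then forces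
    \<open>e = 0\<close>.\<close>
  define e where "e = c *\<^sub>R x - f x"
  have eW: "e \<in> W" unfolding e_def using xW inv W by (simp add: subspace_diff subspace_scale)
  have "e = 0"
  proof (rule ccontr)
    assume "e \<noteq> 0"
    define p where "p = \<beta> e e"
    define r where "r = c * \<beta> e e - \<beta> e (f e)"
    have p: "p > 0" and r: "r \<ge> 0"
      using pos[OF \<open>e \<noteq> 0\<close>] c_le[OF eW] by (auto simp: p_def r_def)
    have xx: "\<beta> x (f x) = c * \<beta> x x" using pos[OF x0] by (simp add: c_def)
    have "\<beta> e x * c - \<beta> e (f x) = p"
      unfolding p_def by (simp add: e_def \<beta>.diff_right \<beta>.scaleR_right algebra_simps)
    then have ex: "\<beta> e (f x) = \<beta> e x * c - p" by simp
    have xe: "\<beta> x (f e) = \<beta> e (f x)" using self_adj sym by metis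
    have ge: "0 \<le> 2 * t * p + t * t * r" for t
    proof -
      have "x + t *\<^sub>R e \<in> W" using xW eW W by (simp add: subspace_add subspace_scale)
      from c_le[OF this] show ?thesis
        by (simp add: f_simps \<beta>.add_left \<beta>.add_right \<beta>.scaleR_left \<beta>.scaleR_right xx xe ex
            r_def sym[of x e] algebra_simps)
    qed
    \<comment> \<open>A small negative \<open>t\<close> makes the linear term
      \<open>2 * t * p\<close> dominate. The choice \<open>t = - (p / (r + 1))\<close> is small
      enough and also covers \<open>r = 0\<close>.\<close>
    have "2 * (- (p / (r + 1))) * p + (- (p / (r + 1))) * (- (p / (r + 1))) * r
        = - (p * p / (r + 1)) * (1 + 1 / (r + 1))"
      using r by (simp add: divide_simps) (simp add: algebra_simps)
    also have "\<dots> < 0"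
      using p r by (intro mult_neg_pos) (auto intro!: divide_pos_pos add_pos_nonneg)
    finally show False using ge[of "- (p / (r + 1))"] by linarith
  qed
  then have "f x = c *\<^sub>R x" unfolding e_def by simp
  with xW x0 that show thesis by blast
qed

lemma self_adjoint_eigenvectors_span:
  fixes f :: "'a::euclidean_space \<Rightarrow> 'a" and \<beta> :: "'a \<Rightarrow> 'a \<Rightarrow> real"
  assumes \<beta>: "bounded_bilinear \<beta>" and sym: "\<And>x y. \<beta> x y = \<beta> y x"
    and pos: "\<And>x. x \<noteq> 0 \<Longrightarrow> 0 < \<beta> x x"
    and f: "linear f" and self_adj: "\<And>x y. \<beta> (f x) y = \<beta> x (f y)"
  shows "span {x. \<exists>c. f x = c *\<^sub>R x} = UNIV"
proof (rule ccontr)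
  interpret \<beta>: bounded_bilinear \<beta> by (rule \<beta>)
  define E where "E = {x. \<exists>c. f x = c *\<^sub>R x}"
  assume "span {x. \<exists>c. f x = c *\<^sub>R x} \<noteq> UNIV"
  then have "span E \<subset> span UNIV" unfolding E_def by auto
  then obtain v where v: "v \<noteq> 0" "\<And>y. y \<in> span E \<Longrightarrow> orthogonal v y"
    using orthogonal_to_subspace_exists_gen by metis
  \<comment> \<open>\<open>R\<close> represents \<open>\<beta>\<close> by the inner product. Being
    surjective, it turns the Euclidean normal \<open>v\<close> of \<open>span E\<close> into a
    \<open>\<beta>\<close>-normal \<open>z\<close> with \<open>v = R z\<close>.\<close>
  define R where "R = (\<lambda>z. \<Sum>b\<in>Basis. \<beta> b z *\<^sub>R b)"
  have R: "x \<bullet> R z = \<beta> x z" for x z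
  proof -
    have "x \<bullet> R z = (\<Sum>b\<in>Basis. \<beta> ((x \<bullet> b) *\<^sub>R b) z)"
      by (simp add: R_def inner_sum_right \<beta>.scaleR_left mult.commute)
    also have "\<dots> = \<beta> x z"
      by (simp flip: \<beta>.sum_left add: euclidean_representation)
    finally show ?thesis .
  qed
  have "linear R"
    unfolding R_def
    by (intro linear_compose_sum ballI linearI)
      (simp_all add: \<beta>.add_right \<beta>.scaleR_right scaleR_add_left)
  moreover have "inj R"
    unfolding linear_injective_0[OF \<open>linear R\<close>] using R pos by (metis inner_zero_right less_irrefl)
  ultimately have "surj R" using linear_injective_imp_surjective by blast
  then obtain z where z: "v = R z" by auto
  define W where "W = {y. \<forall>x\<in>E. \<beta> x y = 0}"
  have "z \<in> W"
    unfolding W_def using v(2) z R by (auto simp: orthogonal_def inner_commute span_base)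
  moreover have "z \<noteq> 0" using z v(1) linear_0[OF \<open>linear R\<close>] by auto
  ultimately have "W \<noteq> {0}" by blast
  moreover have "subspace W"
    unfolding W_def by (rule subspaceI) (auto simp: \<beta>.zero_right \<beta>.add_right \<beta>.scaleR_right)
  \<comment> \<open>For an eigenvector \<open>x\<close> with eigenvalue \<open>c\<close>,
    self-adjointness gives \<open>\<beta> x (f y) = c * \<beta> x y = 0\<close>.\<close>
  moreover have "f y \<in> W" if "y \<in> W" for y
    using that unfolding W_def E_def
    by (auto simp flip: self_adj simp: \<beta>.scaleR_left)
  ultimately obtain x c where x: "x \<in> W" "x \<noteq> 0" "f x = c *\<^sub>R x"
    using self_adjoint_invariant_subspace_eigenvector[OF \<beta> sym pos f self_adj, of W]
    by blast
  \<comment> \<open>The eigenvector \<open>x\<close> lies both in \<open>E\<close> and in its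
    complement \<open>W\<close>, so it is \<open>\<beta>\<close>-orthogonal to itself.\<close>
  then have "\<beta> x x = 0" unfolding W_def E_def by blast
  with pos[OF x(2)] show False by simp
qed

section \<open>Diagonalizing a matrix whose eigenvectors span\<close>

lemma matrix_inv_mult:
  fixes A :: "real^'n^'n"
  assumes "invertible A"
  shows "A ** matrix_inv A = mat 1" "matrix_inv A ** A = mat 1"
proof -
  have "A ** matrix_inv A = mat 1 \<and> matrix_inv A ** A = mat 1"
    using assms unfolding invertible_def matrix_inv_def by (rule someI_ex)
  then show "A ** matrix_inv A = mat 1" "matrix_inv A ** A = mat 1" by auto
qed

text \<open>A basis chosen among the eigenvectors has as many elements as the index type; as columns
  of \<open>Q\<close> it yields \<open>A ** Q = Q ** D\<close>.\<close>

lemma real_diagonalizable_if_eigenvectors_span: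
  fixes A :: "real^'n^'n"
  assumes "span {x. \<exists>c. A *v x = c *\<^sub>R x} = UNIV"
  shows "real_diagonalizable A"
proof -
  obtain S where S: "S \<subseteq> {x. \<exists>c. A *v x = c *\<^sub>R x}" "independent S"
    and span: "{x. \<exists>c. A *v x = c *\<^sub>R x} \<subseteq> span S"
    using maximal_independent_subset by blast
  have span_S: "span S = UNIV"
    using span_minimal[OF span subspace_span] assms by blast
  have "card S = CARD('n)"
    using dim_span_eq_card_independent[OF S(2)] by (simp add: span_S)
  moreover have "finite S" using S(2) by (rule independent_imp_finite)
  ultimately obtain v where v: "bij_betw v (UNIV :: 'n set) S"
    using finite_same_card_bij[of "UNIV :: 'n set" S] by auto
  then have "\<exists>c. A *v v j = c *\<^sub>R v j" for j
    using S(1) by (auto simp: bij_betw_def)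
  then obtain c where c: "\<And>j. A *v v j = c j *\<^sub>R v j" by metis
  define Q :: "real^'n^'n" where "Q = (\<chi> i j. v j $ i)"
  define D :: "real^'n^'n" where "D = (\<chi> i j. if i = j then c j else 0)"
  have col: "column j Q = v j" for j
    by (simp add: Q_def column_def vec_eq_iff)
  have "columns Q = S"
    using v by (auto simp: columns_def col bij_betw_def)
  then have "invertible Q"
    using span_S matrix_right_invertible_span_columns[of Q]
    by (simp add: invertible_right_inverse span_vec_eq)
  then have Q: "Q ** matrix_inv Q = mat 1"
    by (rule matrix_inv_mult)
  have "(A ** Q) $ i $ j = (Q ** D) $ i $ j" for i j
  proof -
    have "(A ** Q) $ i $ j = (A *v v j) $ i"
      by (simp add: matrix_matrix_mult_def matrix_vector_mult_def Q_def)
    also have "\<dots> = (Q ** D) $ i $ j"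
      by (simp add: c matrix_matrix_mult_def Q_def D_def if_distrib cong: if_cong)
    finally show ?thesis .
  qed
  then have "A ** Q = Q ** D" by (simp add: vec_eq_iff)
  then have "A = Q ** D ** matrix_inv Q"
    using Q by (metis matrix_mul_assoc matrix_mul_rid)
  then show ?thesis
    unfolding real_diagonalizable_def using \<open>invertible Q\<close>
    by (intro exI[of _ Q] exI[of _ D]) (auto simp: D_def)
qed

section \<open>Differentiating solutions of linear systems\<close>

text \<open>Supplies the product rule for matrix-vector products.\<close>

lemma bounded_bilinear_matrix_vector_mult:
  "bounded_bilinear ((*v) :: real^'n^'m \<Rightarrow> real^'n \<Rightarrow> real^'m)"
  unfolding bilinear_conv_bounded_bilinear[symmetric] bilinear_def
  by (intro conjI allI linearI)
    (simp_all add: matrix_vector_mult_add_rdistrib matrix_vector_right_distrib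
      matrix_vector_mult_scaleR flip: scaleR_matrix_vector_assoc)

lemma differentiable_prod:
  fixes f :: "'i \<Rightarrow> 'a::real_normed_vector \<Rightarrow> 'b::real_normed_field"
  assumes "\<And>i. i \<in> I \<Longrightarrow> f i differentiable (at x within S)"
  shows "(\<lambda>x. \<Prod>i\<in>I. f i x) differentiable (at x within S)"
proof -
  obtain f' where "\<And>i. i \<in> I \<Longrightarrow> (f i has_derivative f' i) (at x within S)"
    using assms unfolding differentiable_def by metis
  then show ?thesis
    unfolding differentiable_def by (intro exI) (rule has_derivative_prod)
qed

text \<open>By the Leibniz formula the determinant is a polynomial in the entries.\<close>

lemma differentiable_det:
  fixes A :: "'a::real_normed_vector \<Rightarrow> real^'n^'n"
  assumes "\<And>i j. (\<lambda>x. A x $ i $ j) differentiable (at x)"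
  shows "(\<lambda>x. det (A x)) differentiable (at x)"
  unfolding det_def
  by (intro differentiable_sum ballI differentiable_mult differentiable_const differentiable_prod)
    (simp_all add: assms)

lemma matrix_inv_mult_vector:
  fixes A :: "real^'n^'n"
  assumes "invertible A"
  shows "A *v (matrix_inv A *v b) = b" "matrix_inv A *v (A *v b) = b"
  by (simp_all add: matrix_vector_mul_assoc matrix_inv_mult[OF assms])

text \<open>Cramer's rule gives differentiability of the solution; its derivative then comes from
  differentiating the equation \<open>A x *v u x = b x\<close>.\<close>

lemma has_derivative_matrix_inv_mult:
  fixes A :: "'a::euclidean_space \<Rightarrow> real^'n^'n" and b :: "'a \<Rightarrow> real^'n"
  assumes A: "(A has_derivative A') (at x)" and b: "(b has_derivative b') (at x)"
    and inv: "invertible (A x)"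
  shows "((\<lambda>x. matrix_inv (A x) *v b x) has_derivative
    (\<lambda>d. matrix_inv (A x) *v (b' d - A' d *v (matrix_inv (A x) *v b x)))) (at x)"
proof -
  interpret mv: bounded_bilinear "(*v) :: real^'n^'n \<Rightarrow> real^'n \<Rightarrow> real^'n"
    by (rule bounded_bilinear_matrix_vector_mult)
  have Aij: "(\<lambda>x. A x $ i $ j) differentiable (at x)" for i j
    using bounded_linear.has_derivative[OF bounded_linear_compose[OF bounded_linear_vec_nth bounded_linear_vec_nth] A]
    unfolding differentiable_def by blast
  have bi: "(\<lambda>x. b x $ i) differentiable (at x)" for i
    using bounded_linear.has_derivative[OF bounded_linear_vec_nth b]
    unfolding differentiable_def by blast
  have replaced: "(\<lambda>x. if j = k then b x $ i else A x $ i $ j) differentiable (at x)" for i j k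
    by (cases "j = k") (simp_all add: Aij bi)
  have det: "(\<lambda>x. det (A x)) differentiable (at x)"
    by (intro differentiable_det Aij)
  have "isCont (\<lambda>x. det (A x)) x"
    using det by (rule differentiable_imp_continuous_within)
  \<comment> \<open>Cramer's formula and the linear equation are used only at invertible
    \<open>A y\<close>; continuity of the determinant provides this near \<open>x\<close>.\<close>
  then have "\<forall>\<^sub>F y in at x. det (A y) \<noteq> 0"
    using inv unfolding isCont_def invertible_det_nz by (rule tendsto_imp_eventually_ne)
  then have ev: "\<forall>\<^sub>F y in at x. invertible (A y)"
    by (simp add: invertible_det_nz)
  define u where "u = (\<lambda>x. matrix_inv (A x) *v b x)"
  define w :: "'a \<Rightarrow> real^'n"
    where "w = (\<lambda>x. \<chi> k. det (\<chi> i j. if j = k then b x $ i else A x $ i $ j) / det (A x))"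
  have w_u: "w y = u y" if "invertible (A y)" for y
    using cramer[of "A y" "u y" "b y"] that
    unfolding u_def w_def by (simp add: matrix_inv_mult_vector flip: invertible_det_nz)
  have "(\<lambda>x. w x $ k) differentiable (at x)" for k
    unfolding w_def vec_lambda_beta
    by (intro differentiable_divide differentiable_det det)
      (simp_all add: replaced inv[unfolded invertible_det_nz])
  then have "w differentiable (at x)"
    unfolding differentiable_componentwise_within[of w] by (auto simp: Basis_vec_def inner_axis)
  then obtain u' where "(w has_derivative u') (at x)"
    unfolding differentiable_def by blast
  then have u': "(u has_derivative u') (at x)"
    by (rule has_derivative_transform_eventually)
      (auto simp: w_u inv intro: eventually_mono[OF ev])
  have "((\<lambda>x. A x *v u x) has_derivative (\<lambda>d. A x *v u' d + A' d *v u x)) (at x)"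
    by (rule mv.FDERIV[OF A u'])
  \<comment> \<open>Near \<open>x\<close> the product equals \<open>b\<close>, so uniqueness of
    derivatives gives a linear equation for \<open>u'\<close>.\<close>
  moreover have "((\<lambda>x. A x *v u x) has_derivative b') (at x)"
    by (rule has_derivative_transform_eventually[OF b])
      (auto simp: u_def matrix_inv_mult_vector inv intro: eventually_mono[OF ev])
  ultimately have "(\<lambda>d. A x *v u' d + A' d *v u x) = b'"
    by (rule has_derivative_unique)
  then have "A x *v u' d = b' d - A' d *v u x" for d
    by (metis add_diff_cancel_right')
  then have "u' = (\<lambda>d. matrix_inv (A x) *v (b' d - A' d *v u x))"
    by (metis matrix_inv_mult_vector(2) inv)
  with u' show ?thesis unfolding u_def by simp
qed

section \<open>Galerkin matrices of the shallow water system\<close>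

lemma galerkin_P_nth:
  "galerkin_P \<rho> \<phi> y $ l $ m = (\<Sum>k\<in>UNIV. y $ k * weighted_inner \<rho> (\<phi> k) (\<lambda>s. \<phi> l s * \<phi> m s))"
  by (simp add: galerkin_P_def galerkin_M_def)

lemma linear_galerkin_P: "linear (galerkin_P \<rho> \<phi>)"
  by (intro linearI)
    (simp_all add: vec_eq_iff galerkin_P_nth algebra_simps sum.distrib sum_distrib_left)

lemma transpose_galerkin_P: "transpose (galerkin_P \<rho> \<phi> y) = galerkin_P \<rho> \<phi> y"
  by (simp add: vec_eq_iff transpose_def galerkin_P_nth mult.commute)

text \<open>The integral of a triple product of basis functions is symmetric in its three indices,
  so the summation indices \<open>k\<close> and \<open>m\<close> can be exchanged.\<close>

lemma galerkin_P_commute: "galerkin_P \<rho> \<phi> y *v z = galerkin_P \<rho> \<phi> z *v y"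
proof -
  have triple: "weighted_inner \<rho> (\<phi> k) (\<lambda>s. \<phi> l s * \<phi> m s) =
      weighted_inner \<rho> (\<phi> m) (\<lambda>s. \<phi> l s * \<phi> k s)" for k l m
    unfolding weighted_inner_def by (simp add: mult_ac)
  have "(\<Sum>m\<in>UNIV. galerkin_P \<rho> \<phi> y $ l $ m * z $ m) =
      (\<Sum>m\<in>UNIV. galerkin_P \<rho> \<phi> z $ l $ m * y $ m)" for l
    unfolding galerkin_P_nth sum_distrib_right
    by (subst sum.swap) (intro sum.cong refl, subst triple, simp add: mult_ac)
  then show ?thesis by (simp add: vec_eq_iff matrix_vector_mult_def)
qed

lemma symmetric_matrix_inner:
  fixes A :: "real^'n^'n"
  assumes "transpose A = A"
  shows "(A *v x) \<bullet> y = x \<bullet> (A *v y)"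
  by (metis assms dot_lmul_matrix transpose_matrix_vector)

text \<open>A kernel vector \<open>v\<close> satisfies \<open>v \<bullet> (A *v v) = 0\<close>,
  hence vanishes.\<close>

lemma strictly_pos_def_invertible:
  assumes "strictly_pos_def A"
  shows "invertible A"
  unfolding invertible_left_inverse matrix_left_invertible_ker
  using assms by (metis strictly_pos_def_def inner_zero_right less_irrefl)

section \<open>The flux and its derivative\<close>

lemma vjoin_simps [simp]:
  "vfst (vjoin h q) = h" "vsnd (vjoin h q) = q"
  by (simp_all add: vfst_def vsnd_def vjoin_def)

lemma vfst_vsnd_eqI: "vfst U = vfst V \<Longrightarrow> vsnd U = vsnd V \<Longrightarrow> U = V"
  by (simp add: vec_eq_iff vfst_def vsnd_def) (metis sumE)

lemma linear_vfst: "linear vfst" and linear_vsnd: "linear vsnd"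
  by (auto intro!: linearI simp: vec_eq_iff vfst_def vsnd_def)

lemma has_derivative_vjoin:
  assumes "(f has_derivative f') (at x within S)" "(g has_derivative g') (at x within S)"
  shows "((\<lambda>x. vjoin (f x) (g x)) has_derivative (\<lambda>d. vjoin (f' d) (g' d))) (at x within S)"
proof -
  have "linear (\<lambda>p. vjoin (fst p) (snd p))"
    by (intro linearI) (auto simp: vec_eq_iff vjoin_def split: sum.split)
  then have "bounded_linear (\<lambda>p. vjoin (fst p) (snd p))"
    by (rule linear_linear[THEN iffD2])
  from bounded_linear.has_derivative[OF this has_derivative_Pair[OF assms]]
  show ?thesis by simp
qed

text \<open>The variation of the velocity \<open>u\<close> is kept as one term,
  \<open>matrix_inv (P h) *v (vsnd d - P u *v vfst d)\<close>; expanding it gives the usual block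
  Jacobian.\<close>

lemma sgswe_flux_has_derivative:
  fixes \<rho> :: "real^'d::finite \<Rightarrow> real" and \<phi> :: "'k::finite \<Rightarrow> real^'d \<Rightarrow> real" and h q :: "real^'k"
  defines "P \<equiv> galerkin_P \<rho> \<phi>"
  assumes inv: "invertible (P h)"
  defines "u \<equiv> matrix_inv (P h) *v q"
  shows "(sgswe_flux \<rho> \<phi> g has_derivative
    (\<lambda>d. vjoin (vsnd d) (g *\<^sub>R (P h *v vfst d) + P u *v vsnd d +
       P q *v (matrix_inv (P h) *v (vsnd d - P u *v vfst d))))) (at (vjoin h q))"
proof -
  interpret mv: bounded_bilinear "(*v) :: real^'k^'k \<Rightarrow> real^'k \<Rightarrow> real^'k"
    by (rule bounded_bilinear_matrix_vector_mult)
  have fst: "(vfst has_derivative vfst) (at (vjoin h q))"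
    and snd: "(vsnd has_derivative vsnd) (at (vjoin h q))"
    by (auto intro!: linear_imp_has_derivative linear_vfst linear_vsnd)
  have P: "bounded_linear P"
    unfolding P_def by (rule linear_linear[THEN iffD2, OF linear_galerkin_P])
  have comm: "P y *v z = P z *v y" for y z
    unfolding P_def by (rule galerkin_P_commute)
  note Pfst = bounded_linear.has_derivative[OF P fst]
  note Psnd = bounded_linear.has_derivative[OF P snd]
  have inv': "invertible (P (vfst (vjoin h q)))" using inv by simp
  have flux: "sgswe_flux \<rho> \<phi> g = (\<lambda>U. vjoin (vsnd U)
      ((g / 2) *\<^sub>R (P (vfst U) *v vfst U) + P (vsnd U) *v (matrix_inv (P (vfst U)) *v vsnd U)))"
    by (simp add: fun_eq_iff sgswe_flux_def P_def Let_def matrix_vector_mul_assoc)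
  have vel: "((\<lambda>U. matrix_inv (P (vfst U)) *v vsnd U) has_derivative
      (\<lambda>d. matrix_inv (P h) *v (vsnd d - P (vfst d) *v u))) (at (vjoin h q))"
    using has_derivative_matrix_inv_mult[OF Pfst snd inv'] by (simp add: u_def)
  have "(sgswe_flux \<rho> \<phi> g has_derivative (\<lambda>d. vjoin (vsnd d)
      ((g / 2) *\<^sub>R (P h *v vfst d + P (vfst d) *v h) +
        (P q *v (matrix_inv (P h) *v (vsnd d - P (vfst d) *v u)) + P (vsnd d) *v u))))
      (at (vjoin h q))"
    unfolding flux
    using has_derivative_vjoin[OF snd has_derivative_add[OF
        has_derivative_scaleR_right[OF mv.FDERIV[OF Pfst fst], of "g / 2"] mv.FDERIV[OF Psnd vel]]]
    by (simp add: u_def)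
  \<comment> \<open>Commutation makes the two product-rule terms equal, which absorbs the factor one
    half.\<close>
  moreover have "(g / 2) *\<^sub>R (P h *v a + P a *v h) = g *\<^sub>R (P h *v a)" for a
    by (simp add: comm[of a h] flip: scaleR_2)
  ultimately show ?thesis
    by (simp add: comm[of _ u] add_ac)
qed

section \<open>A symmetrizing form for the flux Jacobian\<close>

theorem theorem3p1:
  fixes \<rho> :: "real^'d::finite \<Rightarrow> real"
    and \<Lambda> :: "('d \<Rightarrow> nat) set"
    and \<phi> :: "'k::finite \<Rightarrow> real^'d \<Rightarrow> real"
    and k1 :: 'k
    and g :: real
    and B :: "real \<Rightarrow> real^'k"
    and h q :: "real^'k"
  assumes "prob_density \<rho>"
    and "finite_moments \<rho>"
    and "finite \<Lambda>"
    and "(\<lambda>_. 0) \<in> \<Lambda>"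
    and "card \<Lambda> = CARD('k)"
    and "orthonormal_basis \<rho> (poly_space \<Lambda>) \<phi>"
    and "\<phi> k1 = (\<lambda>_. 1)"
    and "g > 0"
    and "strictly_pos_def (galerkin_P \<rho> \<phi> h)"
  shows "hyperbolic_at (sgswe \<rho> \<phi> g B) (vjoin h q)"
proof -
  define P where "P = galerkin_P \<rho> \<phi>"
  define R where "R = matrix_inv (P h)"
  define u where "u = R *v q"
  define w where "w = (\<lambda>U. vsnd U - P u *v vfst U)"
  \<comment> \<open>In the coordinates \<open>(a, w) = (vfst U, vsnd U - P u *v vfst U)\<close> the Jacobian is
    \<open>(a, w) \<mapsto> (P u *v a + w, g *\<^sub>R (P h *v a) + P q *v (R *v w))\<close>, and weighting
    the two components by \<open>g\<close> and \<open>R\<close> makes all its blocks symmetric.\<close>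
  define \<beta> where "\<beta> = (\<lambda>U V. g * (vfst U \<bullet> vfst V) + w U \<bullet> (R *v w V))"
  define J where "J = (\<lambda>d. vjoin (vsnd d) (g *\<^sub>R (P h *v vfst d) + P u *v vsnd d +
    P q *v (R *v w d)))"
  have inv: "invertible (P h)"
    using assms(9) unfolding P_def by (rule strictly_pos_def_invertible)
  have deriv: "(sgswe_flux \<rho> \<phi> g has_derivative J) (at (vjoin h q))"
    using sgswe_flux_has_derivative[of \<rho> \<phi> h g q] inv
    by (simp add: P_def J_def R_def u_def w_def)
  then have diff: "sgswe_flux \<rho> \<phi> g differentiable (at (vjoin h q))"
    unfolding differentiable_def by blast
  \<comment> \<open>The Jacobian matrix also represents the derivative, so uniqueness of derivatives
    identifies it with \<open>J\<close>.\<close>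
  have J: "jacobian (sgswe_flux \<rho> \<phi> g) (at (vjoin h q)) *v d = J d" for d
    using diff[unfolded jacobian_works] deriv has_derivative_unique by metis
  have P_sym: "(P y *v a) \<bullet> b = a \<bullet> (P y *v b)" for y a b
    unfolding P_def by (intro symmetric_matrix_inner transpose_galerkin_P)
  note PR [simp] = matrix_inv_mult_vector[OF inv, folded R_def]
  have R_sym: "(R *v a) \<bullet> b = a \<bullet> (R *v b)" for a b
    by (metis P_sym PR(1))
  have R_nonneg: "0 \<le> a \<bullet> (R *v a)" and R_pos: "a \<noteq> 0 \<Longrightarrow> 0 < a \<bullet> (R *v a)" for a
  proof -
    show pos: "0 < a \<bullet> (R *v a)" if "a \<noteq> 0"
    proof -
      \<comment> \<open>Positivity of \<open>R\<close> is that of \<open>P h\<close> at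
        \<open>R *v a\<close>, because \<open>P h *v (R *v a) = a\<close>.\<close>
      have "R *v a \<noteq> 0" using PR(1)[of a] that by (metis matrix_vector_mult_0_right)
      with assms(9) have "0 < (R *v a) \<bullet> (P h *v (R *v a))"
        unfolding strictly_pos_def_def P_def by blast
      then show ?thesis by (simp add: inner_commute)
    qed
    then show "0 \<le> a \<bullet> (R *v a)" by (cases "a = 0") auto
  qed
  note lin = linear_add[OF linear_vfst] linear_add[OF linear_vsnd]
    linear_scale[OF linear_vfst] linear_scale[OF linear_vsnd]
  have w_lin: "w (U + V) = w U + w V" "w (c *\<^sub>R U) = c *\<^sub>R w U" for U V c
    by (simp_all add: w_def lin matrix_vector_right_distrib matrix_vector_mult_scaleR
        scaleR_diff_right)
  have "bounded_bilinear \<beta>"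
    unfolding bilinear_conv_bounded_bilinear[symmetric] bilinear_def \<beta>_def
    by (auto intro!: linearI simp: lin w_lin inner_add_left inner_add_right
        matrix_vector_right_distrib matrix_vector_mult_scaleR algebra_simps)
  moreover have \<beta>_sym: "\<beta> U V = \<beta> V U" for U V
    unfolding \<beta>_def using R_sym[of "w U" "w V"] by (simp add: inner_commute)
  \<comment> \<open>If \<open>vfst U = 0\<close>, then \<open>w U\<close> is \<open>vsnd U\<close>,
    which is nonzero; otherwise the first term of \<open>\<beta>\<close> is already
    positive.\<close>
  moreover have "0 < \<beta> U U" if "U \<noteq> 0" for U
  proof (cases "vfst U = 0")
    case True
    have "vsnd U \<noteq> 0"
      using that vfst_vsnd_eqI[of U 0] True linear_0[OF linear_vfst] linear_0[OF linear_vsnd] by auto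
    then show ?thesis using R_pos[of "vsnd U"] True by (simp add: \<beta>_def w_def)
  next
    case False
    then show ?thesis unfolding \<beta>_def using R_nonneg[of "w U"] \<open>g > 0\<close>
      by (intro add_pos_nonneg) auto
  qed
  moreover have "linear J"
    using deriv by (rule has_derivative_linear)
  moreover have "\<beta> (J U) V = \<beta> U (J V)" for U V
  proof -
    have w_J: "w (J U) = g *\<^sub>R (P h *v vfst U) + P q *v (R *v w U)" for U
      by (simp add: w_def J_def)
    have vsnd_w: "vsnd U = w U + P u *v vfst U" for U
      by (simp add: w_def)
    \<comment> \<open>The weight \<open>R\<close> cancels \<open>P h\<close> in the term
      \<open>g *\<^sub>R (P h *v vfst U)\<close>, so the two mixed terms are exchanged by swapping
      \<open>U\<close> and \<open>V\<close>. The other two are symmetric because \<open>P u\<close>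
      and \<open>P q\<close> are.\<close>
    have "\<beta> (J U) V = g * (w U \<bullet> vfst V) + g * (vfst U \<bullet> (P u *v vfst V)) +
        g * (vfst U \<bullet> w V) + (R *v w U) \<bullet> (P q *v (R *v w V))" for U V
      unfolding \<beta>_def w_J
      by (simp add: J_def vsnd_w inner_add_left P_sym algebra_simps)
    from this[of U V] this[of V U] show ?thesis
      using P_sym[of u "vfst U" "vfst V"] P_sym[of q "R *v w U" "R *v w V"]
      by (simp add: \<beta>_sym[of U] inner_commute)
  qed
  ultimately have "span {U. \<exists>c. J U = c *\<^sub>R U} = UNIV"
    by (rule self_adjoint_eigenvectors_span)
  then show ?thesis
    unfolding hyperbolic_at_def sgswe_def using diff
    by (simp add: J real_diagonalizable_if_eigenvectors_span)
qed

end
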